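(* There is a constant $c>0$ such that for every $n\ge 2$ there exists a two-dimensional wireless network $\mathcal{A}=\langle 2,S,\psi,N,\beta,2\rangle$ with $n$ stations in which the reception zone $H_1(\mathcal{A})$ of one station $s_1$ has at least $c\,n$ cells; i.e., $\mu_1(\mathcal{A})=\Omega(n)$.
   Context: A wireless network $\mathcal{A}=\langle d,S,\psi,N,\beta,\alpha\rangle$ consists of a dimension $d$, stations $S=\{s_1,\dots,s_n\}\subset\mathbb{R}^d$, powers $\psi_i>0$, noise $N\ge0$, threshold $\beta\ge1$ and path-loss exponent $\alpha>0$. For $p\notin S$, $\mathrm{SINR}(s_i,p)=\psi_i\|s_i-p\|^{-\alpha}/(\sum_{j\ne i}\psi_j\|s_j-p\|^{-\alpha}+N)$, and $H_i(\mathcal{A})=\{p\in\mathbb{R}^d\setminus S:\mathrm{SINR}(s_i,p)\ge\beta\}\cup\{s_i\}$. $\mu_i(\mathcal{A})$ is the number of cells (maximal connected components) of $H_i(\mathcal{A})$. *)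

theory Defs
  imports "HOL-Analysis.Analysis" "HOL-Library.Extended_Nat" "HOL-Library.Extended_Real"
begin

text \<open>
  The dimension d of a network is not a field of the record: it is the dimension of the
  type \<open>'a\<close> of points.  The stations are \<open>station A i\<close> for \<open>i\<close> in \<open>{1..num_stations A}\<close>;
  values of \<open>station\<close> and \<open>tx_power\<close> at other indices are irrelevant.
\<close>

record 'a wireless_network =
  num_stations :: nat
  station :: "nat \<Rightarrow> 'a"
  tx_power :: "nat \<Rightarrow> real"
  noise :: real
  threshold :: real
  path_loss :: real

definition stations :: "('a, 'z) wireless_network_scheme \<Rightarrow> 'a set" where
  "stations A = station A ` {1..num_stations A}"

text \<open>Injectivity expresses that \<open>s\<^sub>1, \<dots>, s\<^sub>n\<close> are n distinct stations.\<close>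

definition is_wireless_network :: "('a::euclidean_space, 'z) wireless_network_scheme \<Rightarrow> bool" where
  "is_wireless_network A \<longleftrightarrow>
     inj_on (station A) {1..num_stations A} \<and>
     (\<forall>i\<in>{1..num_stations A}. tx_power A i > 0) \<and>
     noise A \<ge> 0 \<and> threshold A \<ge> 1 \<and> path_loss A > 0"

text \<open>
  Meaningful for \<open>p \<notin> stations A\<close>.  The denominator is then positive, except for a
  single station without noise, where division by zero yields 0 rather than infinity.
\<close>

definition SINR :: "('a::euclidean_space, 'z) wireless_network_scheme \<Rightarrow> nat \<Rightarrow> 'a \<Rightarrow> real" where
  "SINR A i p =
     tx_power A i * norm (station A i - p) powr (- path_loss A) /
     ((\<Sum>j\<in>{1..num_stations A} - {i}. tx_power A j * norm (station A j - p) powr (- path_loss A))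
       + noise A)"

definition reception_zone :: "('a::euclidean_space, 'z) wireless_network_scheme \<Rightarrow> nat \<Rightarrow> 'a set" where
  "reception_zone A i =
     {p. p \<notin> stations A \<and> SINR A i p \<ge> threshold A} \<union> {station A i}"

text \<open>Valued in \<^typ>\<open>enat\<close>, since \<^const>\<open>card\<close> of an infinite set of cells would be 0.\<close>

definition num_cells :: "('a::euclidean_space, 'z) wireless_network_scheme \<Rightarrow> nat \<Rightarrow> enat" where
  "num_cells A i =
     (if finite (components (reception_zone A i))
      then enat (card (components (reception_zone A i))) else \<infinity>)"

end

theory Submission
  imports Defs
begin

text \<open>
  The potential \<open>\<Sum> 1 / r\<^sup>2\<close> of four unit stations at the corners of a square of side 2 has value
  2 at the centre, but at least 9/4 on the whole boundary.  Place about \<open>n / 4\<close> such squares at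
  mutual distance \<open>D = 10 n\<close>, so that they hardly influence each other, and let the signal of a
  strong and distant station \<open>s\<^sub>1\<close> be nearly constant, about 21/10, on all of them.  Then \<open>s\<^sub>1\<close> is
  heard at the centre of every square and nowhere on its boundary.
\<close>

section \<open>The network in coordinates\<close>

definition corner :: "nat \<Rightarrow> real \<times> real" where
  "corner j = (if j mod 4 < 2 then 1 else - 1, if even j then 1 else - 1)"

text \<open>Square k holds the stations 4k, ..., 4k+3: \<open>j div 4\<close> is the square and
  \<open>j mod 4\<close> the corner. Square 0 is incomplete, since index 0 is no station and index 1
  is the strong one; the last square may be incomplete too. The squares spread over a width of about
  10 n^2 / 4, so the height 100 n^2 keeps the strong signal almost constant. Its power is scaled to
  give exactly 21/10 at the origin, a value between 2 and 9/4.\<close>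

definition squares_network :: "nat \<Rightarrow> (real ^ 2) wireless_network" where
  "squares_network n =
     \<lparr> num_stations = n,
       station = (\<lambda>j. if j = 1 then vector [0, 100 * real n ^ 2]
                 else vector [10 * real n * real (j div 4) + fst (corner j), snd (corner j)]),
       tx_power = (\<lambda>j. if j = 1 then 21 / 10 * (100 * real n ^ 2)\<^sup>2 else 1),
       noise = 0, threshold = 1, path_loss = 2 \<rparr>"

definition square_centre :: "nat \<Rightarrow> nat \<Rightarrow> real ^ 2" where
  "square_centre n k = vector [10 * real n * real k, 0]"

text \<open>This is the denominator of \<open>SINR (squares_network n) 1 p\<close>, in
  coordinates.\<close>

definition interference :: "nat \<Rightarrow> real ^ 2 \<Rightarrow> real" where
  "interference n p = (\<Sum>j\<in>{1..n} - {1}.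
     1 / ((10 * real n * real (j div 4) + fst (corner j) - p $ 1)\<^sup>2 + (snd (corner j) - p $ 2)\<^sup>2))"

lemma squares_network_simps [simp]:
  "num_stations (squares_network n) = n" "path_loss (squares_network n) = 2"
  "noise (squares_network n) = 0" "threshold (squares_network n) = 1"
  by (simp_all add: squares_network_def)

lemma norm_powr_minus2:
  fixes v :: "real ^ 2"
  shows "norm v powr (- 2) = 1 / ((v $ 1)\<^sup>2 + (v $ 2)\<^sup>2)"
proof -
  have "(norm v)\<^sup>2 = (v $ 1)\<^sup>2 + (v $ 2)\<^sup>2"
    unfolding power2_norm_eq_inner by (simp add: inner_vec_def sum_2 power2_eq_square)
  \<comment> \<open>At v = 0 both sides are 0, by \<open>0 powr a = 0\<close> and
    \<open>1 / 0 = 0\<close>, so the formula extends to the stations themselves.\<close>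
  moreover have "norm v powr (- 2) = 1 / (norm v)\<^sup>2"
    by (cases "v = 0") (simp_all add: powr_minus divide_inverse)
  ultimately show ?thesis by simp
qed

lemma SINR_squares_network:
  "SINR (squares_network n) 1 p =
     21 / 10 * (100 * real n ^ 2)\<^sup>2 / ((p $ 1)\<^sup>2 + (100 * real n ^ 2 - p $ 2)\<^sup>2) / interference n p"
proof -
  have fields: "station (squares_network n) 1 = vector [0, 100 * real n ^ 2]"
    "tx_power (squares_network n) 1 = 21 / 10 * (100 * real n ^ 2)\<^sup>2"
    by (simp_all add: squares_network_def)
  have sum: "(\<Sum>j\<in>{1..n} - {1}. tx_power (squares_network n) j *
          norm (station (squares_network n) j - p) powr (- 2)) = interference n p"
    unfolding interference_def
    by (rule sum.cong) (auto simp: squares_network_def norm_powr_minus2)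
  show ?thesis
    unfolding SINR_def squares_network_simps fields sum
    unfolding norm_powr_minus2 by simp
qed

lemma one_le_SINR_squares_network_iff:
  assumes "0 < interference n p"
  shows "1 \<le> SINR (squares_network n) 1 p \<longleftrightarrow> interference n p
    \<le> 21 / 10 * (100 * real n ^ 2)\<^sup>2 / ((p $ 1)\<^sup>2 + (100 * real n ^ 2 - p $ 2)\<^sup>2)"
  unfolding SINR_squares_network by (rule le_divide_eq_1_pos[OF assms])

section \<open>Potential on the boundary of one square\<close>

text \<open>AM-GM: the terms are squares of two numbers with product 1 / (1 - y^2) \<ge> 1. They are
  the potentials of the two ends of a side at a point on that side.\<close>

lemma inverse_square_sum_ge:
  fixes y :: real
  assumes "\<bar>y\<bar> < 1"
  shows "2 \<le> 1 / (1 - y)\<^sup>2 + 1 / (1 + y)\<^sup>2"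
proof -
  define a where "a = 1 / (1 - y)"
  define b where "b = 1 / (1 + y)"
  have "a * b = 1 / (1 - y\<^sup>2)"
    by (simp add: a_def b_def power2_eq_square algebra_simps)
  moreover have "0 < 1 - y\<^sup>2"
    using assms by (simp add: abs_square_less_1)
  ultimately have "1 \<le> a * b" by simp
  moreover have "2 * (a * b) \<le> a\<^sup>2 + b\<^sup>2"
    using sum_squares_bound[of a b] by simp
  ultimately show ?thesis by (simp add: a_def b_def power_divide)
qed

text \<open>The near corners contribute at least 2. The far ones are on the opposite side, at
  squared distance at most 4 + 4, so each adds at least 1/8.\<close>

lemma edge_potential_ge:
  fixes y :: real
  assumes "\<bar>y\<bar> < 1"
  shows "9 / 4 \<le> 1 / (1 - y)\<^sup>2 + 1 / (1 + y)\<^sup>2 + 1 / (4 + (1 - y)\<^sup>2) + 1 / (4 + (1 + y)\<^sup>2)"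
proof -
  have far: "1 / 8 \<le> 1 / (4 + t\<^sup>2)" if "\<bar>t\<bar> \<le> 2" for t :: real
  proof -
    have "t\<^sup>2 \<le> 2\<^sup>2" using that by (metis abs_le_square_iff abs_numeral)
    then show ?thesis by (intro divide_left_mono) (auto intro: add_pos_nonneg)
  qed
  show ?thesis
    using inverse_square_sum_ge[OF assms] far[of "1 - y"] far[of "1 + y"] assms by force
qed

text \<open>By symmetry each of the four sides reduces to the previous bound. The second hypothesis
  excludes the corners, where \<open>1 / 0 = 0\<close> would drop the sum to 5/8.\<close>

lemma square_boundary_potential_ge:
  fixes u v :: real
  assumes "max \<bar>u\<bar> \<bar>v\<bar> = 1" "\<bar>u\<bar> < 1 \<or> \<bar>v\<bar> < 1"
  shows "9 / 4 \<le> 1 / ((1 - u)\<^sup>2 + (1 - v)\<^sup>2) + 1 / ((1 - u)\<^sup>2 + (- 1 - v)\<^sup>2)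
               + 1 / ((- 1 - u)\<^sup>2 + (1 - v)\<^sup>2) + 1 / ((- 1 - u)\<^sup>2 + (- 1 - v)\<^sup>2)"
proof -
  have sq: "(- 1 - t)\<^sup>2 = (1 + t)\<^sup>2" for t :: real
    by (simp add: power2_eq_square algebra_simps)
  have "\<bar>v\<bar> < 1 \<and> (u = 1 \<or> u = - 1) \<or> \<bar>u\<bar> < 1 \<and> (v = 1 \<or> v = - 1)"
    using assms by (auto simp: max_def split: if_splits)
  then show ?thesis
    using edge_potential_ge[of u] edge_potential_ge[of v] unfolding sq by (auto simp: add_ac)
qed

section \<open>Indexing by square and corner\<close>

lemma sum_block4:
  fixes f :: "nat \<Rightarrow> real"
  shows "sum f {4 * k..4 * k + 3} = f (4 * k) + f (4 * k + 1) + f (4 * k + 2) + f (4 * k + 3)"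
proof -
  have "{4 * k..4 * k + 3} = {4 * k, 4 * k + 1, 4 * k + 2, 4 * k + 3}" by auto
  then show ?thesis by simp
qed

lemma corner_block4:
  "corner (4 * k) = (1, 1)" "corner (4 * k + 1) = (1, - 1)"
  "corner (4 * k + 2) = (- 1, 1)" "corner (4 * k + 3) = (- 1, - 1)"
proof -
  have mod4: "(4 * k) mod 4 = 0" "(4 * k + 1) mod 4 = 1" "(4 * k + 2) mod 4 = 2"
    "(4 * k + 3) mod 4 = 3"
    by (simp_all del: add_2_eq_Suc')
  show "corner (4 * k) = (1, 1)" "corner (4 * k + 1) = (1, - 1)"
    "corner (4 * k + 2) = (- 1, 1)" "corner (4 * k + 3) = (- 1, - 1)"
    unfolding corner_def mod4 by simp_all
qed

lemma corner_eq_imp_mod_eq: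
  assumes "corner i = corner j"
  shows "i mod 4 = j mod 4"
proof -
  have parity: "even m \<longleftrightarrow> even (m mod 4)" for m :: nat by (simp add: dvd_mod_iff)
  have cases4: "m mod 4 = 0 \<or> m mod 4 = 1 \<or> m mod 4 = 2 \<or> m mod 4 = 3" for m :: nat
    using mod_less_divisor[of 4 m] by linarith
  have "(i mod 4 < 2) = (j mod 4 < 2)" "even (i mod 4) = even (j mod 4)"
    using assms by (auto simp: corner_def parity[symmetric] split: if_splits)
  then show ?thesis using cases4[of i] cases4[of j] by (elim disjE) simp_all
qed

lemma div_block4:
  "(4 * k) div 4 = k" "(4 * k + 1) div 4 = k" "(4 * k + 2) div 4 = k" "(4 * k + 3) div 4 = (k :: nat)"
  by simp_all

section \<open>Reception at the centres, none on the boundaries\<close>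

text \<open>The hypotheses say that all four corners of square k are present as unit stations. They
  contribute 4 * 1/2 = 2; the remaining stations, at most n of them, add at most n / (9n)^2
  together.\<close>

lemma interference_square_centre_le:
  assumes "1 \<le> k" "4 * k + 3 \<le> n"
  shows "0 < interference n (square_centre n k)" "interference n (square_centre n k) \<le> 2 + 1 / 100"
proof -
  define f where "f j = 1 / ((10 * real n * real (j div 4) + fst (corner j) - square_centre n k $ 1)\<^sup>2
    + (snd (corner j) - square_centre n k $ 2)\<^sup>2)" for j
  let ?B = "{4 * k..4 * k + 3}" and ?J = "{1..n} - {1}"
  have sub: "?B \<subseteq> ?J" using assms by auto
  have split: "interference n (square_centre n k) = sum f ?B + sum f (?J - ?B)"
    unfolding interference_def f_def[symmetric]
    by (subst sum.subset_diff[OF sub]) (auto simp: add.commute)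
  have block: "sum f ?B = 2"
    unfolding sum_block4 f_def corner_block4 div_block4 by (simp add: square_centre_def)
  have pos: "0 \<le> f j" for j by (simp add: f_def)
  \<comment> \<open>Another square is horizontally at least 10 n away, and the offset of its corner
    costs at most 1 \<le> n.\<close>
  have far: "f j \<le> 1 / (9 * real n)\<^sup>2" if j: "j \<in> ?J - ?B" for j
  proof -
    have ne: "j div 4 \<noteq> k" using j by auto
    define t where "t = real (j div 4) - real k"
    have "1 \<le> \<bar>t\<bar>" using ne unfolding t_def by linarith
    then have "10 * real n \<le> \<bar>10 * real n * t\<bar>"
      using mult_left_mono[of 1 "\<bar>t\<bar>" "10 * real n"] by (simp add: abs_mult)
    moreover have "\<bar>fst (corner j)\<bar> = 1" by (simp add: corner_def)
    ultimately have "9 * real n \<le> \<bar>10 * real n * t + fst (corner j)\<bar>"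
      using assms by linarith
    then have "(9 * real n)\<^sup>2 \<le> (10 * real n * t + fst (corner j))\<^sup>2"
      using power_mono[of "9 * real n" "\<bar>10 * real n * t + fst (corner j)\<bar>" 2] by simp
    also have "10 * real n * t + fst (corner j)
        = 10 * real n * real (j div 4) + fst (corner j) - square_centre n k $ 1"
      by (simp add: square_centre_def t_def algebra_simps)
    finally have "(9 * real n)\<^sup>2
        \<le> (10 * real n * real (j div 4) + fst (corner j) - square_centre n k $ 1)\<^sup>2
        + (snd (corner j) - square_centre n k $ 2)\<^sup>2"
      by (rule add_increasing2[OF zero_le_power2])
    moreover have "0 < (9 * real n)\<^sup>2" using assms by simp
    ultimately show ?thesis
      unfolding f_def by (intro divide_left_mono mult_pos_pos) linarith+
  qed
  have "sum f (?J - ?B) \<le> real (card (?J - ?B)) * (1 / (9 * real n)\<^sup>2)"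
    using far by (rule sum_bounded_above)
  also have "\<dots> \<le> real n * (1 / (9 * real n)\<^sup>2)"
  proof -
    have "card (?J - ?B) \<le> card {1..n}" by (rule card_mono) auto
    then show ?thesis by (intro mult_right_mono) auto
  qed
  also have "\<dots> = 1 / (81 * real n)" using assms by (simp add: power2_eq_square)
  \<comment> \<open>The hypotheses force n \<ge> 7, so 81 n exceeds 100.\<close>
  also have "\<dots> \<le> 1 / 100" using assms by simp
  finally show "interference n (square_centre n k) \<le> 2 + 1 / 100" using split block by simp
  show "0 < interference n (square_centre n k)"
    using split block sum_nonneg[of "?J - ?B" f] pos by simp
qed

lemma square_centre_in_reception_zone:
  assumes "1 \<le> k" "4 * k + 3 \<le> n"
  shows "square_centre n k \<in> reception_zone (squares_network n) 1"
proof -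
  have "square_centre n k \<notin> stations (squares_network n)"
  proof
    assume "square_centre n k \<in> stations (squares_network n)"
    then obtain j where "square_centre n k = station (squares_network n) j"
      by (auto simp: stations_def)
    then have "square_centre n k $ 2 = station (squares_network n) j $ 2" by simp
    then show False using assms
      by (simp add: squares_network_def square_centre_def corner_def split: if_splits)
  qed
  moreover have "1 \<le> SINR (squares_network n) 1 (square_centre n k)"
  proof -
    define x where "x = real n ^ 2"
    have x: "0 < x" using assms by (simp add: x_def)
    have kx: "real n * real k \<le> x"
      unfolding x_def power2_eq_square using assms by (intro mult_left_mono) auto
    \<comment> \<open>The horizontal displacement adds at most one percent to the squared distance
      from \<open>s_1\<close>, so the signal is at least 210/101 > 2.07, above the interference
      bound 2.01.\<close>
    have "(10 * real n * real k)\<^sup>2 \<le> (10 * x)\<^sup>2"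
      by (rule power_mono) (use kx in auto)
    then have le: "(10 * real n * real k)\<^sup>2 + (100 * x)\<^sup>2 \<le> 101 / 100 * (100 * x)\<^sup>2"
      by (simp add: power_mult_distrib)
    have "2 + 1 / 100 \<le> 21 / 10 * (100 * x)\<^sup>2 / (101 / 100 * (100 * x)\<^sup>2)"
      using x by (simp add: field_simps)
    also have "\<dots> \<le> 21 / 10 * (100 * x)\<^sup>2 / ((10 * real n * real k)\<^sup>2 + (100 * x)\<^sup>2)"
      using x by (intro divide_left_mono le mult_pos_pos add_nonneg_pos) auto
    finally have "interference n (square_centre n k)
        \<le> 21 / 10 * (100 * x)\<^sup>2 / ((10 * real n * real k)\<^sup>2 + (100 * x)\<^sup>2)"
      using interference_square_centre_le(2)[OF assms] by (rule order_trans[rotated])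
    then show ?thesis
      using one_le_SINR_squares_network_iff[OF interference_square_centre_le(1)[OF assms]]
      by (simp add: square_centre_def x_def)
  qed
  ultimately show ?thesis
    by (simp add: reception_zone_def)
qed

text \<open>The square's own corners already give interference 9/4, while the signal is at most
  21/10 * (100/99)^2 < 2.15. The corners themselves lie outside the zone because they are stations
  other than \<open>s_1\<close>.\<close>

lemma square_boundary_not_in_reception_zone:
  assumes k: "1 \<le> k" "4 * k + 3 \<le> n"
    and bd: "max \<bar>p $ 1 - 10 * real n * real k\<bar> \<bar>p $ 2\<bar> = 1"
  shows "p \<notin> reception_zone (squares_network n) 1"
proof
  assume p: "p \<in> reception_zone (squares_network n) 1"
  let ?D = "10 * real n * real k"
  define x where "x = real n ^ 2"
  have "1 \<le> x" using k by (simp add: x_def)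
  have y: "\<bar>p $ 2\<bar> \<le> 1" using bd by linarith
  have "p \<noteq> station (squares_network n) 1"
    using y \<open>1 \<le> x\<close> by (auto simp: squares_network_def x_def)
  then have nst: "p \<notin> stations (squares_network n)" and S: "1 \<le> SINR (squares_network n) 1 p"
    using p by (auto simp: reception_zone_def)
  have "\<bar>p $ 1 - ?D\<bar> < 1 \<or> \<bar>p $ 2\<bar> < 1"
  proof (rule ccontr)
    assume "\<not> (\<bar>p $ 1 - ?D\<bar> < 1 \<or> \<bar>p $ 2\<bar> < 1)"
    then have "\<bar>p $ 1 - ?D\<bar> = 1" "\<bar>p $ 2\<bar> = 1" using bd by auto
    then have "(p $ 1 = ?D + 1 \<or> p $ 1 = ?D - 1) \<and> (p $ 2 = 1 \<or> p $ 2 = - 1)"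
      by linarith
    then have "\<exists>j\<in>{4 * k, 4 * k + 1, 4 * k + 2, 4 * k + 3}.
        p $ 1 = ?D + fst (corner j) \<and> p $ 2 = snd (corner j)"
      unfolding bex_simps corner_block4 by auto
    then obtain j where j: "j \<in> {4 * k, 4 * k + 1, 4 * k + 2, 4 * k + 3}"
      "p $ 1 = ?D + fst (corner j)" "p $ 2 = snd (corner j)" by blast
    have "4 * k \<le> j" "j \<le> 4 * k + 3" using j(1) by auto
    with k have "j div 4 = k" "j \<noteq> 1" "j \<in> {1..n}" by auto
    then have "p $ i = station (squares_network n) j $ i" for i
      using exhaust_2[of i] j(2,3) by (auto simp: squares_network_def)
    then have "p = station (squares_network n) j" by (simp add: vec_eq_iff)
    with \<open>j \<in> {1..n}\<close> nst show False by (auto simp: stations_def)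
  qed
  note pot = square_boundary_potential_ge[OF bd this]
  define f where "f j = 1 / ((10 * real n * real (j div 4) + fst (corner j) - p $ 1)\<^sup>2
    + (snd (corner j) - p $ 2)\<^sup>2)" for j
  have "9 / 4 \<le> sum f {4 * k..4 * k + 3}"
    unfolding sum_block4 f_def corner_block4 div_block4 using pot by (simp add: algebra_simps)
  also have "\<dots> \<le> interference n p"
    unfolding interference_def f_def[symmetric]
    using k by (intro sum_mono2) (auto simp: f_def)
  finally have I: "9 / 4 \<le> interference n p" .
  have d: "(99 * x)\<^sup>2 \<le> (p $ 1)\<^sup>2 + (100 * x - p $ 2)\<^sup>2"
  proof -
    \<comment> \<open>The vertical distance alone suffices: 100 x - 1 \<ge> 99 x because x \<ge>
      1.\<close>
    have "(99 * x)\<^sup>2 \<le> (100 * x - p $ 2)\<^sup>2"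
      by (rule power_mono) (use y \<open>1 \<le> x\<close> in linarith)+
    then show ?thesis by (simp add: add_increasing)
  qed
  have "interference n p \<le> 21 / 10 * (100 * x)\<^sup>2 / ((p $ 1)\<^sup>2 + (100 * x - p $ 2)\<^sup>2)"
    using S I one_le_SINR_squares_network_iff[of n p] unfolding x_def by linarith
  also have "\<dots> \<le> 21 / 10 * (100 * x)\<^sup>2 / (99 * x)\<^sup>2"
  proof (rule divide_left_mono[OF d])
    have "0 < (99 * x)\<^sup>2" using \<open>1 \<le> x\<close> by simp
    with d show "0 < ((p $ 1)\<^sup>2 + (100 * x - p $ 2)\<^sup>2) * (99 * x)\<^sup>2"
      by (intro mult_pos_pos) linarith+
  qed auto
  also have "\<dots> < 9 / 4" using \<open>1 \<le> x\<close> by (simp add: power_mult_distrib)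
  finally show False using I by simp
qed

section \<open>Counting cells\<close>

lemma square_centres_not_connected:
  assumes "1 \<le> k" "4 * k + 3 \<le> n" "k \<noteq> l"
  shows "\<not> connected_component (reception_zone (squares_network n) 1)
            (square_centre n k) (square_centre n l)"
proof
  let ?Z = "reception_zone (squares_network n) 1"
  \<comment> \<open>The maximum-norm distance from the centre of square k: its level set at 1 is the
    boundary of the square. On a connected set containing both centres it takes the value 0 and a
    value \<ge> 1, hence also 1, at a point outside the zone.\<close>
  define g where "g p = max \<bar>p $ 1 - 10 * real n * real k\<bar> \<bar>p $ 2\<bar>" for p :: "real ^ 2"
  assume "connected_component ?Z (square_centre n k) (square_centre n l)"
  then obtain C where C: "connected C" "C \<subseteq> ?Z" "square_centre n k \<in> C" "square_centre n l \<in> C"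
    by (auto simp: connected_component_def)
  have "continuous_on C g" unfolding g_def by (intro continuous_intros)
  then have "connected (g ` C)" using C(1) by (rule connected_continuous_image)
  moreover have "g (square_centre n k) = 0" by (simp add: g_def square_centre_def)
  moreover have "1 \<le> g (square_centre n l)"
  proof -
    have "1 \<le> \<bar>real l - real k\<bar>" using assms(3) by linarith
    then have "10 * real n * 1 \<le> 10 * real n * \<bar>real l - real k\<bar>" by (intro mult_left_mono) auto
    also have "\<dots> = \<bar>10 * real n * real l - 10 * real n * real k\<bar>"
      by (simp add: abs_mult flip: right_diff_distrib)
    finally show ?thesis using assms by (simp add: g_def square_centre_def)
  qed
  ultimately have "1 \<in> g ` C"
    using C(3,4) connectedD_interval[of "g ` C" 0 "g (square_centre n l)" 1]
    by (metis imageI zero_le_one)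
  then obtain p where "p \<in> C" "g p = 1" by auto
  then show False
    using C(2) square_boundary_not_in_reception_zone[OF assms(1,2)] unfolding g_def by blast
qed

text \<open>Mapping k to the component of \<open>q k\<close> injects K into the cells. If there are
  infinitely many cells, \<open>num_cells\<close> is \<infinity> and the bound is trivial.\<close>

lemma num_cells_ge:
  assumes "finite K" "\<And>k. k \<in> K \<Longrightarrow> q k \<in> reception_zone A i"
    and "\<And>k l. k \<in> K \<Longrightarrow> l \<in> K \<Longrightarrow> k \<noteq> l \<Longrightarrow> \<not> connected_component (reception_zone A i) (q k) (q l)"
  shows "enat (card K) \<le> num_cells A i"
proof (cases "finite (components (reception_zone A i))")
  case True
  let ?c = "\<lambda>k. connected_component_set (reception_zone A i) (q k)"
  have "inj_on ?c K"
    using assms(2,3) by (auto simp: inj_on_def connected_component_eq_eq)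
  moreover have "?c ` K \<subseteq> components (reception_zone A i)"
    using assms(2) by (auto simp: components_def)
  ultimately have "card K \<le> card (components (reception_zone A i))"
    using True by (metis card_image card_mono)
  then show ?thesis using True by (simp add: num_cells_def)
qed (simp add: num_cells_def)

text \<open>The work is in the distinctness of the stations: height separates \<open>s_1\<close>
  from the others, the first coordinate determines the square, and the remaining offset determines
  the corner.\<close>

lemma is_wireless_network_squares_network:
  assumes "1 \<le> n"
  shows "is_wireless_network (squares_network n)"
proof -
  have "i = j" if i: "1 \<le> i" and j: "1 \<le> j"
    and eq: "station (squares_network n) i = station (squares_network n) j" for i j
  proof -
    let ?s = "\<lambda>i. station (squares_network n) i"
    have n2: "1 \<le> real n ^ 2" using assms by simp
    have y1: "snd (corner i) \<noteq> 100 * real n ^ 2" for i using n2 by (auto simp: corner_def)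
    have y: "?s i $ 2 = ?s j $ 2" and x: "?s i $ 1 = ?s j $ 1" using eq by simp_all
    have *: "i = 1 \<longleftrightarrow> j = 1"
      using y y1[of i] y1[of j] by (auto simp: squares_network_def split: if_splits)
    show ?thesis
    proof (cases "i = 1")
      case False
      then have x': "10 * real n * real (i div 4) + fst (corner i)
          = 10 * real n * real (j div 4) + fst (corner j)"
        and y': "snd (corner i) = snd (corner j)"
        using x y * by (auto simp: squares_network_def)
      have "\<bar>fst (corner i)\<bar> = 1" "\<bar>fst (corner j)\<bar> = 1" by (auto simp: corner_def)
      \<comment> \<open>Two corner offsets differ by at most 2, whereas different squares are at
        least 10 n apart.\<close>
      then have small: "\<bar>10 * real n * (real (i div 4) - real (j div 4))\<bar> \<le> 2"
        using x' unfolding right_diff_distrib by linarith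
      have "i div 4 = j div 4"
      proof (rule ccontr)
        assume "i div 4 \<noteq> j div 4"
        then have "1 \<le> \<bar>real (i div 4) - real (j div 4)\<bar>" by linarith
        then have "10 * real n * 1 \<le> 10 * real n * \<bar>real (i div 4) - real (j div 4)\<bar>"
          by (intro mult_left_mono) auto
        with small assms show False by (simp add: abs_mult)
      qed
      moreover from this have "corner i = corner j" using x' y' by (simp add: prod_eq_iff)
      then have "i mod 4 = j mod 4" by (rule corner_eq_imp_mod_eq)
      ultimately show ?thesis by (metis div_mult_mod_eq)
    qed (use * in simp)
  qed
  then have "inj_on (station (squares_network n)) {1..n}" by (auto simp: inj_on_def)
  then show ?thesis using assms by (auto simp: is_wireless_network_def squares_network_def)
qed

theorem theorem5p14:
  "\<exists>c::real. c > 0 \<and>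
     (\<forall>n::nat. n \<ge> 2 \<longrightarrow>
       (\<exists>A :: (real ^ 2) wireless_network.
          is_wireless_network A \<and> num_stations A = n \<and> path_loss A = 2 \<and>
          ereal (c * real n) \<le> ereal_of_enat (num_cells A 1)))"
proof (intro exI[of _ "1 / 10"] conjI allI impI)
  fix n :: nat
  assume n: "2 \<le> n"
  let ?A = "squares_network n"
  \<comment> \<open>With m = (n - 3) div 4 complete squares beyond square 0, n \<le> 4 m + 6, which
    is at most 10 m once m \<ge> 1; hence the constant 1/10.\<close>
  have "\<exists>m. real n \<le> 10 * real m \<and> enat m \<le> num_cells ?A 1"
  proof (cases "n < 10")
    case True
    \<comment> \<open>For n < 10 one cell is enough, and \<open>s_1\<close> always belongs to its
      own zone.\<close>
    have "enat (card {()}) \<le> num_cells ?A 1"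
      by (rule num_cells_ge[where q = "\<lambda>_. station ?A 1"]) (auto simp: reception_zone_def)
    with True show ?thesis by (intro exI[of _ 1]) auto
  next
    case False
    let ?K = "{1..(n - 3) div 4}"
    have "4 * k + 3 \<le> n" if "k \<in> ?K" for k using that by auto
    then have "enat (card ?K) \<le> num_cells ?A 1"
      by (intro num_cells_ge[where q = "square_centre n"] square_centre_in_reception_zone
          square_centres_not_connected) auto
    moreover have "n \<le> 10 * ((n - 3) div 4)"
    proof -
      have "1 \<le> (n - 3) div 4" using False by (simp add: less_eq_div_iff_mult_less_eq)
      moreover have "n - 3 < 4 + (n - 3) div 4 * 4" by (rule dividend_less_div_times) simp
      ultimately show ?thesis by linarith
    qed
    ultimately show ?thesis by (intro exI[of _ "(n - 3) div 4"]) auto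
  qed
  then obtain m where m: "real n \<le> 10 * real m" "enat m \<le> num_cells ?A 1" by blast
  have "ereal (1 / 10 * real n) \<le> ereal_of_enat (enat m)" using m(1) by simp
  also have "\<dots> \<le> ereal_of_enat (num_cells ?A 1)" using m(2) by (simp only: ereal_of_enat_le_iff)
  finally show "\<exists>A :: (real ^ 2) wireless_network. is_wireless_network A \<and> num_stations A = n \<and>
      path_loss A = 2 \<and> ereal (1 / 10 * real n) \<le> ereal_of_enat (num_cells A 1)"
    using is_wireless_network_squares_network[of n] n
    by (intro exI[of _ ?A]) simp
qed simp

end
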